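(* Let $(X,\rho)$ be a $\rho$-metric space. The $\rho$-metric $\rho$ is linear if and only if there is a function $\Phi\colon X\to\mathbb{R}$ (called a potential of $\rho$) such that $$\rho(x,y)=\Phi(y)-\Phi(x)\qquad\text{for all }x,y\in X.$$ Moreover, if $X\neq\varnothing$, the potential $\Phi$ of a linear $\rho$-metric is determined up to an additive constant: fixing an arbitrary point $x_0\in X$, one can always take $\Phi(x_0)=0$ and $\Phi(x)=\rho(x_0,x)$.
   Context: The extended real line $[-\infty,\infty]$ has its natural order and the extended sum $\lambda+\mu$, where $-\infty+\infty=\infty$. A $\rho$-metric on a set $X$ is a mapping $\rho\colon X\times X\to[-\infty,\infty]$ such that $\rho(x,y)+\rho(y,z)\ge\rho(x,z)$ and $0\ge\rho(x,x)$ for all $x,y,z\in X$ (no symmetry or separation is required); $(X,\rho)$ is then called a $\rho$-metric space. The $\rho$-metric is linear if it is finite (it takes values in $\mathbb{R}$) and additive: $\rho(x,y)+\rho(y,z)=\rho(x,z)$ for all $x,y,z\in X$. *)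

theory Defs
  imports "HOL-Library.Extended_Real"
begin

text \<open>
  Addition on \<^typ>\<open>ereal\<close> satisfies \<open>- \<infinity> + \<infinity> = \<infinity>\<close>, which is the convention used for
  the extended sum in the triangle inequality.
\<close>

definition rho_metric_on :: "'a set \<Rightarrow> ('a \<Rightarrow> 'a \<Rightarrow> ereal) \<Rightarrow> bool" where
  "rho_metric_on X \<rho> \<longleftrightarrow>
     (\<forall>x\<in>X. \<forall>y\<in>X. \<forall>z\<in>X. \<rho> x y + \<rho> y z \<ge> \<rho> x z) \<and> (\<forall>x\<in>X. 0 \<ge> \<rho> x x)"

definition linear_rho_metric_on :: "'a set \<Rightarrow> ('a \<Rightarrow> 'a \<Rightarrow> ereal) \<Rightarrow> bool" where
  "linear_rho_metric_on X \<rho> \<longleftrightarrow>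
     rho_metric_on X \<rho> \<and>
     (\<forall>x\<in>X. \<forall>y\<in>X. \<bar>\<rho> x y\<bar> \<noteq> \<infinity>) \<and>
     (\<forall>x\<in>X. \<forall>y\<in>X. \<forall>z\<in>X. \<rho> x y + \<rho> y z = \<rho> x z)"

definition rho_potential_on :: "'a set \<Rightarrow> ('a \<Rightarrow> 'a \<Rightarrow> ereal) \<Rightarrow> ('a \<Rightarrow> real) \<Rightarrow> bool" where
  "rho_potential_on X \<rho> \<Phi> \<longleftrightarrow> (\<forall>x\<in>X. \<forall>y\<in>X. \<rho> x y = ereal (\<Phi> y - \<Phi> x))"

end

theory Submission
  imports Defs
begin

text \<open>Additivity makes a finite \<open>\<rho>\<close> a difference of its values seen from one
  point: \<open>\<rho> x\<^sub>0 x + \<rho> x y = \<rho> x\<^sub>0 y\<close> can be solved for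
  \<open>\<rho> x y\<close>, so \<open>\<rho> x\<^sub>0\<close> itself is a potential
  (\<open>rho_potential_on_base_point\<close>). Conversely, differences of a real function are
  finite and telescope (\<open>rho_potential_on_imp_linear\<close>). Two potentials have the same
  increments, so their difference is constant
  (\<open>rho_potential_on_iff_translate\<close>).\<close>

lemma linear_rho_metric_onD:
  assumes "linear_rho_metric_on X \<rho>" "x \<in> X" "y \<in> X" "z \<in> X"
  shows "ereal (real_of_ereal (\<rho> x y)) = \<rho> x y"
    and "real_of_ereal (\<rho> x y) + real_of_ereal (\<rho> y z) = real_of_ereal (\<rho> x z)"
proof -
  have fin: "\<bar>\<rho> u v\<bar> \<noteq> \<infinity>" if "u \<in> X" "v \<in> X" for u v
    using assms that by (simp add: linear_rho_metric_on_def)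
  have "\<rho> x z = \<rho> x y + \<rho> y z"
    using assms by (simp add: linear_rho_metric_on_def)
  \<comment> \<open>Finiteness is essential here: \<open>real_of_ereal\<close> sends both infinities
    to 0 and is additive only on finite values.\<close>
  then show "real_of_ereal (\<rho> x y) + real_of_ereal (\<rho> y z) = real_of_ereal (\<rho> x z)"
    using fin[OF assms(2,3)] fin[OF assms(3,4)] by auto
  show "ereal (real_of_ereal (\<rho> x y)) = \<rho> x y"
    using fin assms(2,3) by (simp add: ereal_real)
qed

text \<open>Fixing the first argument of \<open>\<rho>\<close> yields the potential normalized at
  that point; this gives both existence and the explicit formula.\<close>

lemma rho_potential_on_base_point:
  assumes lin: "linear_rho_metric_on X \<rho>" and x0: "x\<^sub>0 \<in> X"
  shows "rho_potential_on X \<rho> (\<lambda>x. real_of_ereal (\<rho> x\<^sub>0 x))"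
  unfolding rho_potential_on_def
proof (intro ballI)
  fix x y
  assume xy: "x \<in> X" "y \<in> X"
  \<comment> \<open>Additivity along \<open>x\<^sub>0\<close>, \<open>x\<close>, \<open>y\<close>,
    rearranged in the reals, where subtraction is unproblematic.\<close>
  have "real_of_ereal (\<rho> x y) = real_of_ereal (\<rho> x\<^sub>0 y) - real_of_ereal (\<rho> x\<^sub>0 x)"
    using linear_rho_metric_onD(2)[OF lin x0 xy] by simp
  then show "\<rho> x y = ereal (real_of_ereal (\<rho> x\<^sub>0 y) - real_of_ereal (\<rho> x\<^sub>0 x))"
    using linear_rho_metric_onD(1)[OF lin xy xy(2)] by simp
qed

text \<open>The increments of \<open>\<Phi>\<close> telescope and vanish on the diagonal, so the
  metric axioms hold with equality.\<close>

lemma rho_potential_on_imp_linear: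
  assumes "rho_potential_on X \<rho> \<Phi>"
  shows "linear_rho_metric_on X \<rho>"
  using assms
  by (auto simp: rho_potential_on_def linear_rho_metric_on_def rho_metric_on_def)

lemma rho_potential_on_iff_translate:
  assumes pot: "rho_potential_on X \<rho> \<Phi>"
  shows "rho_potential_on X \<rho> \<Psi> \<longleftrightarrow> (\<exists>c. \<forall>x\<in>X. \<Psi> x = \<Phi> x + c)"
proof
  assume pot': "rho_potential_on X \<rho> \<Psi>"
  have diff: "\<Psi> y - \<Psi> x = \<Phi> y - \<Phi> x" if "x \<in> X" "y \<in> X" for x y
    using pot pot' that unfolding rho_potential_on_def by (metis ereal.inject)
  show "\<exists>c. \<forall>x\<in>X. \<Psi> x = \<Phi> x + c"
  proof (cases "X = {}")
    case False
    then obtain x0 where "x0 \<in> X" by blast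
    \<comment> \<open>The constant is the gap between the two potentials at one chosen point; equal
      increments carry it to every other point.\<close>
    then have "\<forall>x\<in>X. \<Psi> x = \<Phi> x + (\<Psi> x0 - \<Phi> x0)"
      using diff by (simp add: algebra_simps)
    then show ?thesis by blast
  qed simp
next
  assume "\<exists>c. \<forall>x\<in>X. \<Psi> x = \<Phi> x + c"
  with pot show "rho_potential_on X \<rho> \<Psi>"
    by (auto simp: rho_potential_on_def)
qed

theorem mainTheorem1:
  fixes X :: "'a set" and \<rho> :: "'a \<Rightarrow> 'a \<Rightarrow> ereal"
  assumes "rho_metric_on X \<rho>"
  shows "(linear_rho_metric_on X \<rho> \<longleftrightarrow> (\<exists>\<Phi>. rho_potential_on X \<rho> \<Phi>)) \<and>
    (linear_rho_metric_on X \<rho> \<and> X \<noteq> {} \<longrightarrow>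
      (\<forall>\<Phi>. rho_potential_on X \<rho> \<Phi> \<longrightarrow>
        (\<forall>\<Psi>. rho_potential_on X \<rho> \<Psi> \<longleftrightarrow> (\<exists>c::real. \<forall>x\<in>X. \<Psi> x = \<Phi> x + c))) \<and>
      (\<forall>x\<^sub>0\<in>X. \<exists>\<Phi>. rho_potential_on X \<rho> \<Phi> \<and> \<Phi> x\<^sub>0 = 0 \<and>
        (\<forall>x\<in>X. ereal (\<Phi> x) = \<rho> x\<^sub>0 x)))"
proof (intro conjI impI allI ballI)
  show "linear_rho_metric_on X \<rho> \<longleftrightarrow> (\<exists>\<Phi>. rho_potential_on X \<rho> \<Phi>)"
  proof
    assume lin: "linear_rho_metric_on X \<rho>"
    show "\<exists>\<Phi>. rho_potential_on X \<rho> \<Phi>"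
    proof (cases "X = {}")
      \<comment> \<open>There is no base point to choose, but every function is vacuously a
        potential.\<close>
      case True
      then show ?thesis by (simp add: rho_potential_on_def)
    next
      case False
      then show ?thesis using rho_potential_on_base_point[OF lin] by blast
    qed
  qed (blast intro: rho_potential_on_imp_linear)
next
  fix \<Phi> \<Psi>
  assume "rho_potential_on X \<rho> \<Phi>"
  then show "rho_potential_on X \<rho> \<Psi> \<longleftrightarrow> (\<exists>c::real. \<forall>x\<in>X. \<Psi> x = \<Phi> x + c)"
    by (rule rho_potential_on_iff_translate)
next
  fix x\<^sub>0
  assume "linear_rho_metric_on X \<rho> \<and> X \<noteq> {}" and x0: "x\<^sub>0 \<in> X"
  then have lin: "linear_rho_metric_on X \<rho>" by blast
  \<comment> \<open>Additivity with all three points equal gives \<open>a + a = a\<close> for a real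
    \<open>a\<close>; the metric axiom alone would only give \<open>a \<le> 0\<close>.\<close>
  have "real_of_ereal (\<rho> x\<^sub>0 x\<^sub>0) = 0"
    using linear_rho_metric_onD(2)[OF lin x0 x0 x0] by simp
  moreover have "\<forall>x\<in>X. ereal (real_of_ereal (\<rho> x\<^sub>0 x)) = \<rho> x\<^sub>0 x"
    using linear_rho_metric_onD(1)[OF lin x0] by blast
  ultimately show "\<exists>\<Phi>. rho_potential_on X \<rho> \<Phi> \<and> \<Phi> x\<^sub>0 = 0 \<and> (\<forall>x\<in>X. ereal (\<Phi> x) = \<rho> x\<^sub>0 x)"
    using rho_potential_on_base_point[OF lin x0] by blast
qed

end
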